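(* Assume the decay of correlations assumption (DC) stated in the context. Let $r\in B$ be a nonnegative function with $\int r\,d\mu=1$, let $d\nu=r\,d\mu$, let $g_j:\mathcal Y_j\to\mathbb R$, $j\ge0$, be measurable real-valued functions, and let $(b_n)$ be a sequence of positive numbers tending to $\infty$. Let $S_n=\sum_{j=0}^{n-1}g_j\circ\overline X_j$, and let $S_{n,\mu}$ and $S_{n,\nu}$ denote the random variable $S_n=S_n(x)$ when $x$ is distributed according to $\mu$ and $\nu$, respectively. Then for every $n$, every positive integer $\rho<n$, every $T\ge1$ and every real random variable $Z$ with a bounded density function $f_Z$ we have $$d_K(S_{n,\nu}/b_n,Z)\le (4c+1)\,d_K(S_{n,\mu}/b_n,Z)+\frac{2T\mu\big(|S_\rho|(1+r)\big)}{b_n}+4\delta_\rho\|r\|\ln T+\frac{2\|f_Z\|_\infty c^2}{T}+\frac{2\mu\big((r+1)|S_n|\big)}{b_nT},$$ where $c>0$ is the absolute constant which is the root of the equation $\int_0^{c/2}\frac{\sin^2x}{x^2}\,dx=\frac\pi4+\frac18$.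
   Context: $(\mathcal E,\mathcal F,\mu)$ is a probability space, $\mathcal X_0,\mathcal X_1,\dots$ are measurable spaces, and $X_j:\mathcal E\to\mathcal X_j$, $j\ge0$, are measurable maps. Set $\mathcal Y_n=\mathcal X_n\times\mathcal X_{n+1}\times\cdots$ and $\overline X_n(x)=(X_n(x),X_{n+1}(x),X_{n+2}(x),\dots)\in\mathcal Y_n$. For a function $f$ on $\mathcal E$, $\mu(f)=\int f\,d\mu$. Assumption (DC): there is a sequence $(\delta_n)$ converging to $0$ and a set $B$ of real-valued $\mu$-integrable functions on $\mathcal E$ equipped with a "norm" $\|\cdot\|$ (a function $B\to[0,\infty)$) such that for all $n$, all $s\in B$ and all bounded measurable complex-valued functions $f=f(x_n,x_{n+1},\dots)$ on $\mathcal Y_n$, $$\left|\int s\cdot (f\circ\overline X_n)\,d\mu-\int s\,d\mu\cdot\int f\circ\overline X_n\,d\mu\right|\le \|s\|\,\|f\circ\overline X_n\|_{\infty}\,\delta_n,$$ where $\|f\circ\overline X_n\|_\infty$ is the essential supremum with respect to $\mu$. The Kolmogorov metric between the laws of real random variables $X,Y$ is $d_K(X,Y)=\sup_{t\in\mathbb R}|P(X\le t)-P(Y\le t)|$, and $\|f_Z\|_\infty=\sup f_Z$. *)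

theory Defs
  imports "HOL-Probability.Probability"
begin

text \<open>The spaces \<open>Xs 0, Xs 1, \<dots>\<close> are measurable spaces carried by subsets of one type
  \<open>'x\<close>; only their \<open>\<sigma>\<close>-algebras matter.\<close>

definition tail_space :: "(nat \<Rightarrow> 'x measure) \<Rightarrow> nat \<Rightarrow> (nat \<Rightarrow> 'x) measure" where
  "tail_space Xs n = PiM UNIV (\<lambda>k. Xs (n + k))"

definition tail_map :: "(nat \<Rightarrow> 'a \<Rightarrow> 'x) \<Rightarrow> nat \<Rightarrow> 'a \<Rightarrow> nat \<Rightarrow> 'x" where
  "tail_map X n x = (\<lambda>k. X (n + k) x)"

text \<open>For bounded \<open>h\<close> on a probability space the essential supremum of \<open>cmod \<circ> h\<close> is finite,
  so the conversion to a real number loses nothing.\<close>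

definition ess_norm :: "'a measure \<Rightarrow> ('a \<Rightarrow> complex) \<Rightarrow> real" where
  "ess_norm M h = real_of_ereal (esssup M (\<lambda>x. ereal (cmod (h x))))"

definition decay_of_correlations ::
  "'a measure \<Rightarrow> (nat \<Rightarrow> 'x measure) \<Rightarrow> (nat \<Rightarrow> 'a \<Rightarrow> 'x) \<Rightarrow>
   ('a \<Rightarrow> real) set \<Rightarrow> (('a \<Rightarrow> real) \<Rightarrow> real) \<Rightarrow> (nat \<Rightarrow> real) \<Rightarrow> bool" where
  "decay_of_correlations M Xs X B nrm \<delta> \<longleftrightarrow>
     \<delta> \<longlonglongrightarrow> 0 \<and>
     (\<forall>s\<in>B. integrable M s \<and> 0 \<le> nrm s) \<and>
     (\<forall>n. \<forall>s\<in>B. \<forall>f :: (nat \<Rightarrow> 'x) \<Rightarrow> complex.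
        f \<in> borel_measurable (tail_space Xs n) \<longrightarrow>
        bounded (f ` space (tail_space Xs n)) \<longrightarrow>
        cmod ((\<integral>x. complex_of_real (s x) * f (tail_map X n x) \<partial>M)
              - complex_of_real (\<integral>x. s x \<partial>M) * (\<integral>x. f (tail_map X n x) \<partial>M))
          \<le> nrm s * ess_norm M (\<lambda>x. f (tail_map X n x)) * \<delta> n)"

definition birkhoff_sum ::
  "(nat \<Rightarrow> 'a \<Rightarrow> 'x) \<Rightarrow> (nat \<Rightarrow> (nat \<Rightarrow> 'x) \<Rightarrow> real) \<Rightarrow> nat \<Rightarrow> 'a \<Rightarrow> real" where
  "birkhoff_sum X g n x = (\<Sum>j<n. g j (tail_map X j x))"

text \<open>The two random variables may live on different probability spaces.\<close>

definition kolmogorov_dist ::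
  "'a measure \<Rightarrow> ('a \<Rightarrow> real) \<Rightarrow> 'b measure \<Rightarrow> ('b \<Rightarrow> real) \<Rightarrow> real" where
  "kolmogorov_dist M X N Y =
     (SUP t. \<bar>measure M {x \<in> space M. X x \<le> t} - measure N {y \<in> space N. Y y \<le> t}\<bar>)"

text \<open>Existence and uniqueness of the root make the definite description in
  \<open>smoothing_const\<close> below well defined. The integrand at \<open>0\<close> is irrelevant.\<close>

lemma set_integral_sin_sq: assumes "0 \<le> u"
  shows "(LBINT x:{0..u}. (sin x)\<^sup>2 / x\<^sup>2) = integral {0..u} (\<lambda>x. (sinc x)\<^sup>2)"
proof -
  have "(LBINT x:{0..u}. (sin x)\<^sup>2 / x\<^sup>2) = (LBINT x:{0..u}. (sinc x)\<^sup>2)"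
    unfolding set_lebesgue_integral_def
  proof (rule integral_cong_AE)
    have "AE x in lborel. x \<noteq> (0::real)" by (rule AE_lborel_singleton)
    then show "AE x in lborel. indicat_real {0..u} x *\<^sub>R ((sin x)\<^sup>2 / x\<^sup>2) = indicat_real {0..u} x *\<^sub>R (sinc x)\<^sup>2"
      by eventually_elim (simp add: power_divide)
  qed (auto)
  also have "\<dots> = integral {0..u} (\<lambda>x. (sinc x)\<^sup>2)"
    by (intro set_borel_integral_eq_integral borel_integrable_atLeastAtMost' continuous_on_power continuous_on_sinc continuous_on_id)
  finally show ?thesis .
qed

lemma smoothing_const_ex1:
  "\<exists>!c. 0 < c \<and> (LBINT x:{0..c/2}. (sin x)\<^sup>2 / x\<^sup>2) = pi / 4 + 1 / 8"
proof -
  define F where "F u = integral {0..u} (\<lambda>x. (sinc x)\<^sup>2)" for u :: real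
  have cont: "continuous_on S (\<lambda>x. (sinc x)\<^sup>2)" for S
    by (intro continuous_intros continuous_on_sinc)
  have intg: "(\<lambda>x. (sinc x)\<^sup>2) integrable_on {a..b}" for a b
    by (intro integrable_continuous_real cont)
  have F: "(LBINT x:{0..u}. (sin x)\<^sup>2 / x\<^sup>2) = F u" if "0 \<le> u" for u
    using set_integral_sin_sq[OF that] by (simp add: F_def)
  have strict: "F u < F v" if "0 < u" "u < v" "u < 3" for u v
  proof -
    have "F v = F u + integral {u..v} (\<lambda>x. (sinc x)\<^sup>2)"
      unfolding F_def using that by (intro Henstock_Kurzweil_Integration.integral_combine[symmetric] intg) auto
    moreover have "integral {u..v} (\<lambda>x. (sinc x)\<^sup>2) \<ge> 0"
      by (intro integral_nonneg intg) auto
    moreover have "integral {u..v} (\<lambda>x. (sinc x)\<^sup>2) \<noteq> 0"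
    proof
      assume "integral {u..v} (\<lambda>x. (sinc x)\<^sup>2) = 0"
      then have "\<forall>x\<in>{u..v}. (sinc x)\<^sup>2 = 0"
        using integral_eq_0_iff[of u v "\<lambda>x. (sinc x)\<^sup>2"] cont that by auto
      then have "sinc u = 0" using that by auto
      moreover have "0 < sin u" using that pi_gt3 by (intro sin_gt_zero) auto
      ultimately show False using that by auto
    qed
    ultimately show ?thesis by linarith
  qed
  have low: "1 - x\<^sup>2 / 3 \<le> (sinc x)\<^sup>2" if "x \<in> {0..6/5}" for x :: real
  proof (cases "x = 0")
    case False
    then have "0 < x" using that by auto
    have "x - x ^ 3 / 6 \<le> sin x"
    proof -
      obtain t where "0 < t" "t < x" "sin x = (\<Sum>m<4. sin_coeff m * x ^ m) + sin (t + 1/2 * real 4 * pi) / fact 4 * x ^ 4"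
        using Maclaurin_sin_expansion3[of 4 x] \<open>0 < x\<close> by auto
      moreover have "(\<Sum>m<4. sin_coeff m * x ^ m) = x - x ^ 3 / 6"
      proof -
        have "\<not> Suc (Suc 0) dvd Suc (Suc (Suc 0))" by presburger
        then show ?thesis by (simp add: eval_nat_numeral sin_coeff_def fact_numeral)
      qed
      moreover have "sin (t + 1/2 * real 4 * pi) = sin t"
        using sin_periodic[of t] by (simp add: mult.commute)
      moreover have "0 < sin t" using \<open>0 < t\<close> \<open>t < x\<close> that pi_gt3 by (intro sin_gt_zero) auto
      ultimately show ?thesis by simp
    qed
    then have *: "1 - x\<^sup>2 / 6 \<le> sinc x"
      using \<open>0 < x\<close> by (simp add: field_simps power2_eq_square power3_eq_cube)
    have "x\<^sup>2 \<le> (6/5)\<^sup>2" using that by (intro power_mono) auto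
    then have "0 \<le> 1 - x\<^sup>2 / 6" by (simp add: power2_eq_square)
    then have "(1 - x\<^sup>2 / 6)\<^sup>2 \<le> (sinc x)\<^sup>2" using * by (intro power_mono)
    moreover have "(1 - x\<^sup>2 / 6)\<^sup>2 = 1 - x\<^sup>2 / 3 + (x\<^sup>2 / 6)\<^sup>2"
      by (simp add: power2_eq_square field_simps)
    moreover have "0 \<le> (x\<^sup>2 / 6)\<^sup>2" by simp
    ultimately show ?thesis by linarith
  qed auto
  have poly: "((\<lambda>x::real. 1 - x\<^sup>2 / 3) has_integral ((6/5 - (6/5)^3 / 9) - (0 - 0^3/9))) {0..6/5}"
    by (rule fundamental_theorem_of_calculus)
       (auto intro!: derivative_eq_intros simp: has_real_derivative_iff_has_vector_derivative[symmetric] power2_eq_square)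
  have "6/5 - (6/5)^3 / 9 \<le> F (6/5)"
    unfolding F_def using has_integral_le[OF poly integrable_integral[OF intg] low] by simp
  then have F1: "pi / 4 + 1 / 8 \<le> F (6/5)" using pi_approx by (simp add: power3_eq_cube)
  have contF: "continuous_on {0..6/5} F"
    unfolding F_def by (intro indefinite_integral_continuous_1 intg)
  have "F 0 = 0" by (simp add: F_def)
  then obtain u where u: "0 \<le> u" "u \<le> 6/5" "F u = pi / 4 + 1 / 8"
    using IVT'[of F 0 "pi / 4 + 1 / 8" "6/5"] F1 contF pi_gt_zero by auto
  then have u0: "0 < u" using \<open>F 0 = 0\<close> pi_gt_zero by (cases "u = 0") auto
  show ?thesis
  proof (rule ex1I[of _ "2 * u"])
    show "0 < 2 * u \<and> (LBINT x:{0..2 * u / 2}. (sin x)\<^sup>2 / x\<^sup>2) = pi / 4 + 1 / 8"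
      using u u0 F by simp
    fix c assume c: "0 < c \<and> (LBINT x:{0..c/2}. (sin x)\<^sup>2 / x\<^sup>2) = pi / 4 + 1 / 8"
    then have "F (c/2) = F u" using F[of "c/2"] u by simp
    then have "\<not> u < c/2" "\<not> c/2 < u"
      using strict[of u "c/2"] strict[of "c/2" u] u u0 c by auto
    then show "c = 2 * u" by linarith
  qed
qed

definition smoothing_const :: real where
  "smoothing_const = (THE c. 0 < c \<and> (LBINT x:{0..c/2}. (sin x)\<^sup>2 / x\<^sup>2) = pi / 4 + 1 / 8)"

end

theory Submission
  imports Defs
begin

text \<open>Write \<open>V\<close> for the difference of the distribution functions of \<open>S\<^sub>n / b\<^sub>n\<close> under \<open>\<nu>\<close> and \<open>\<mu>\<close>.
  Convolving with the Fejer kernel \<open>sinc\<^sup>2\<close>, rescaled to have Fourier transform supported in \<open>[-T, T]\<close>,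
  bounds the smoothed \<open>V\<close> by the integral of \<open>\<bar>\<mu>((r - 1) e\<^sup>i\<^sup>t\<^sup>S)\<bar> / \<bar>t\<bar>\<close> over \<open>[-T, T]\<close>, where \<open>S = S\<^sub>n / b\<^sub>n\<close>. For
  \<open>\<bar>t\<bar> \<le> 1/T\<close> the integrand is at most \<open>\<mu>(\<bar>r - 1\<bar> \<bar>S\<bar>)\<close>; for larger \<open>t\<close> one drops the first
  \<open>\<rho>\<close> summands at a cost of \<open>\<bar>t\<bar> \<mu>((1 + r) \<bar>S\<^sub>\<rho>\<bar>) / b\<^sub>n\<close> and applies the decay of correlations to the remaining
  ones. To return from the smoothed \<open>V\<close> to \<open>V\<close> one uses that \<open>V\<close> cannot drop much to the right of
  a point: the distribution function under \<open>\<nu>\<close> is monotone, and the one under \<open>\<mu>\<close> is close to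
  a Lipschitz one. The constant \<open>c\<close> is chosen such that the window \<open>\<bar>u\<bar> \<le> c/2\<close> carries mass
  \<open>\<pi>/2 + 1/4\<close> of the total mass \<open>\<pi>\<close> of \<open>sinc\<^sup>2\<close>.\<close>

subsection \<open>The squared sinc kernel\<close>

definition sinc_sq :: "real \<Rightarrow> real" where
  "sinc_sq u = (sinc u)\<^sup>2"

lemma sinc_sq_eq: "u \<noteq> 0 \<Longrightarrow> sinc_sq u = (sin u)\<^sup>2 / u\<^sup>2"
  by (simp add: sinc_sq_def power_divide)

lemma sinc_sq_0 [simp]: "sinc_sq 0 = 1"
  by (simp add: sinc_sq_def)

lemma sinc_sq_minus [simp]: "sinc_sq (- u) = sinc_sq u"
  by (simp add: sinc_sq_def)

lemma sinc_sq_nonneg [simp]: "0 \<le> sinc_sq u"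
  by (simp add: sinc_sq_def)

lemma sinc_sq_le_1: "sinc_sq u \<le> 1"
proof (cases "u = 0")
  case False
  have "\<bar>sin u\<bar>\<^sup>2 \<le> \<bar>u\<bar>\<^sup>2"
    by (intro power_mono abs_sin_x_le_abs_x) simp
  with False show ?thesis by (simp add: sinc_sq_eq divide_le_eq)
qed simp

lemma isCont_sinc_sq: "isCont sinc_sq u"
  unfolding sinc_sq_def[abs_def] by (intro isCont_power isCont_sinc)

lemma borel_measurable_sinc_sq [measurable]: "sinc_sq \<in> borel_measurable borel"
  by (intro borel_measurable_continuous_onI continuous_at_imp_continuous_on ballI isCont_sinc_sq)

text \<open>Integration by parts gives the primitive \<open>Si (2 * u) - (sin u)\<^sup>2 / u\<close>
  on the half line. Its second term vanishes at infinity and \<open>Si\<close> tends to pi/2;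
  evenness of the kernel doubles this value.\<close>

lemma has_bochner_integral_sinc_sq: "has_bochner_integral lborel sinc_sq pi"
proof -
  define F where "F u = Si (2 * u) - u * sinc_sq u" for u
  have deriv: "DERIV F u :> sinc_sq u" for u
  proof (cases "u = 0")
    case True
    \<comment> \<open>Caratheodory's criterion: the difference quotient of
      \<open>u * sinc_sq u\<close> at 0 is \<open>sinc_sq\<close> itself, so continuity of the
      kernel suffices and its derivative is never computed.\<close>
    have "DERIV (\<lambda>u. u * sinc_sq u) 0 :> sinc_sq 0"
      unfolding CARAT_DERIV by (rule exI[of _ sinc_sq]) (simp add: isCont_sinc_sq del: sinc_sq_0)
    moreover have "DERIV (\<lambda>u. Si (2 * u)) 0 :> sinc (2 * 0) * 2"
      by (rule DERIV_chain2[OF DERIV_Si]) (auto intro!: derivative_eq_intros)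
    ultimately have "DERIV F 0 :> sinc (2 * 0) * 2 - sinc_sq 0"
      unfolding F_def by (rule DERIV_diff[rotated])
    with True show ?thesis by simp
  next
    case False
    have "DERIV (\<lambda>u. (sin u)\<^sup>2 / u) u :> 2 * sin u * cos u / u - (sin u)\<^sup>2 / u\<^sup>2"
      using False by (auto intro!: derivative_eq_intros simp: power2_eq_square field_simps)
    then have "DERIV (\<lambda>u. (sin u)\<^sup>2 / u) u :> sin (2 * u) / u - (sin u)\<^sup>2 / u\<^sup>2"
      by (simp only: sin_double)
    moreover have "DERIV (\<lambda>u. Si (2 * u)) u :> sinc (2 * u) * 2"
      by (rule DERIV_chain2[OF DERIV_Si]) (auto intro!: derivative_eq_intros)
    ultimately have "DERIV (\<lambda>u. Si (2 * u) - (sin u)\<^sup>2 / u) u :>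
        sinc (2 * u) * 2 - (sin (2 * u) / u - (sin u)\<^sup>2 / u\<^sup>2)"
      by (rule DERIV_diff[rotated])
    then have "DERIV (\<lambda>u. Si (2 * u) - (sin u)\<^sup>2 / u) u :> sinc_sq u"
      using False by (simp add: sinc_sq_eq)
    then show ?thesis
    proof (rule has_field_derivative_transform_within_open[of _ _ _ "- {0}"])
      show "Si (2 * x) - (sin x)\<^sup>2 / x = F x" if "x \<in> - {0}" for x
        using that by (simp add: F_def sinc_sq_eq power2_eq_square)
    qed (use False in auto)
  qed
  have "filterlim (\<lambda>u::real. 2 * u) at_top at_top"
    by (rule filterlim_tendsto_pos_mult_at_top[OF tendsto_const]) (auto simp: filterlim_ident)
  then have "((\<lambda>u. Si (2 * u)) \<longlongrightarrow> pi / 2) at_top"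
    by (rule filterlim_compose[OF Si_at_top])
  moreover have "((\<lambda>u. u * sinc_sq u) \<longlongrightarrow> 0) at_top"
  proof (rule Lim_null_comparison)
    show "\<forall>\<^sub>F u in at_top. norm (u * sinc_sq u) \<le> inverse u"
      using eventually_gt_at_top[of 0]
    proof eventually_elim
      case (elim u)
      have "(sin u)\<^sup>2 \<le> 1" by (simp add: abs_square_le_1)
      with elim show ?case by (simp add: sinc_sq_eq field_simps power2_eq_square)
    qed
    show "(inverse \<longlongrightarrow> (0::real)) at_top" by (rule tendsto_inverse_0_at_top) (simp add: filterlim_ident)
  qed
  ultimately have "(F \<longlongrightarrow> pi / 2 - 0) at_top"
    unfolding F_def by (rule tendsto_diff)
  then have lim: "(F \<longlongrightarrow> pi / 2) at_top" by simp
  have "Si 0 = 0" by (simp add: Si_def flip: zero_ereal_def)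
  then have "F 0 = 0" by (simp add: F_def)
  with nn_integral_FTC_atLeast[OF _ deriv _ lim, of 0]
  have "(\<integral>\<^sup>+u. ennreal (sinc_sq u) * indicator {0..} u \<partial>lborel) = ennreal (pi / 2)"
    by simp
  then have "has_bochner_integral lborel (\<lambda>u. indicator {0..} u *\<^sub>R sinc_sq u) (pi / 2)"
    by (intro has_bochner_integral_nn_integral)
       (auto simp: indicator_def intro!: nn_integral_cong split: if_splits
             elim!: back_subst[where P="\<lambda>x. x = _"])
  from has_bochner_integral_even_function[OF this] show ?thesis by simp
qed

lemma integrable_sinc_sq: "integrable lborel sinc_sq"
  and integral_sinc_sq: "(\<integral>u. sinc_sq u \<partial>lborel) = pi"
  using has_bochner_integral_sinc_sq by (auto simp: has_bochner_integral_iff)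

lemma smoothing_const_pos: "0 < smoothing_const"
  and smoothing_const_integral:
    "(LBINT x:{0..smoothing_const/2}. (sin x)\<^sup>2 / x\<^sup>2) = pi / 4 + 1 / 8"
  using theI'[OF smoothing_const_ex1] by (auto simp: smoothing_const_def)

text \<open>The equation defining the constant concerns the half window from 0 to c/2 only; by
  evenness the symmetric window carries twice pi/4 + 1/8.\<close>

lemma has_bochner_integral_sinc_sq_window:
  "has_bochner_integral lborel
     (\<lambda>u. indicator {-smoothing_const/2..smoothing_const/2} u *\<^sub>R sinc_sq u) (pi / 2 + 1 / 4)"
proof -
  define h where "h = smoothing_const / 2"
  have h: "0 < h" using smoothing_const_pos by (simp add: h_def)
  have "(LBINT x:{0..h}. (sin x)\<^sup>2 / x\<^sup>2) = (LBINT x:{0..h}. sinc_sq x)"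
    unfolding set_lebesgue_integral_def
  proof (rule integral_cong_AE)
    show "AE x in lborel. indicat_real {0..h} x *\<^sub>R ((sin x)\<^sup>2 / x\<^sup>2) = indicat_real {0..h} x *\<^sub>R sinc_sq x"
      using AE_lborel_singleton[of "0::real"] by eventually_elim (simp add: sinc_sq_eq)
  qed auto
  then have val: "(LBINT x:{0..h}. sinc_sq x) = pi / 4 + 1 / 8"
    using smoothing_const_integral by (simp add: h_def)
  have "integrable lborel (\<lambda>u. indicator {0..h} u *\<^sub>R sinc_sq u)"
    by (intro integrable_mult_indicator integrable_sinc_sq) auto
  with val have "has_bochner_integral lborel (\<lambda>u. indicator {0..h} u *\<^sub>R sinc_sq u) (pi / 4 + 1 / 8)"
    by (simp add: has_bochner_integral_iff set_lebesgue_integral_def)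
  moreover have "(\<lambda>u. indicator {0..h} u *\<^sub>R sinc_sq u)
      = (\<lambda>u. indicator {0..} u *\<^sub>R (indicator {-h..h} u *\<^sub>R sinc_sq u))"
    using h by (auto simp: fun_eq_iff indicator_def)
  ultimately have "has_bochner_integral lborel (\<lambda>u. indicator {-h..h} u *\<^sub>R sinc_sq u) (2 *\<^sub>R (pi / 4 + 1 / 8))"
    by (intro has_bochner_integral_even_function) (auto simp: indicator_def)
  then show ?thesis by (simp add: h_def)
qed

section \<open>The tent function and a Fourier formula for the primitive of the kernel\<close>

definition sin_quot :: "real \<Rightarrow> real \<Rightarrow> real" where
  "sin_quot t y = (if t = 0 then y else sin (t * y) / t)"

text \<open>This form shows that the value y chosen at t = 0 makes \<open>sin_quot\<close> jointly
  continuous, so no singularity at frequency 0 remains in the integrals below.\<close>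

lemma sin_quot_sinc: "sin_quot t y = y * sinc (t * y)"
  by (auto simp: sin_quot_def)

lemma sin_quot_0 [simp]: "sin_quot t 0 = 0"
  by (simp add: sin_quot_def)

lemma continuous_on_sin_quot [continuous_intros]:
  "continuous_on S f \<Longrightarrow> continuous_on S g \<Longrightarrow> continuous_on S (\<lambda>x. sin_quot (f x) (g x))"
  unfolding sin_quot_sinc by (intro continuous_intros)

lemma borel_measurable_sin_quot [measurable (raw)]:
  assumes [measurable]: "f \<in> borel_measurable M" "g \<in> borel_measurable M"
  shows "(\<lambda>x. sin_quot (f x) (g x)) \<in> borel_measurable M"
  unfolding sin_quot_def by measurable

lemma abs_sin_quot_le: "\<bar>sin_quot t y\<bar> \<le> \<bar>y\<bar>"
  using abs_sin_x_le_abs_x[of "t * y"] by (auto simp: sin_quot_def abs_mult field_simps)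

definition sinc_sq_primitive :: "real \<Rightarrow> real" where
  "sinc_sq_primitive y = integral {0..2} (\<lambda>t. (1 - t / 2) * sin_quot t y)"

text \<open>The kernel is the cosine transform of the tent 1 - t/2, which lives on frequencies up to
  2. Integration by parts leaves (1 - cos 2y) / (2 y^2), and the double angle formula
  finishes.\<close>

lemma integral_cos_tent: "integral {0..2} (\<lambda>t. (1 - t / 2) * cos (t * y)) = sinc_sq y"
proof (cases "y = 0")
  case True
  have "((\<lambda>t::real. 1 - t / 2) has_integral ((2 - 2\<^sup>2 / 4) - (0 - 0\<^sup>2 / 4))) {0..2}"
    by (rule fundamental_theorem_of_calculus)
       (auto intro!: derivative_eq_intros simp: has_real_derivative_iff_has_vector_derivative[symmetric])
  with True show ?thesis by (simp add: integral_unique)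
next
  case False
  have "((\<lambda>t. (1 - t / 2) * cos (t * y)) has_integral
      (((1 - 2 / 2) * sin (2 * y) / y - cos (2 * y) / (2 * y\<^sup>2))
       - ((1 - 0 / 2) * sin (0 * y) / y - cos (0 * y) / (2 * y\<^sup>2)))) {0..2}"
    using False
    by (intro fundamental_theorem_of_calculus)
       (auto intro!: derivative_eq_intros simp: has_real_derivative_iff_has_vector_derivative[symmetric]
          power2_eq_square field_simps)
  then have "integral {0..2} (\<lambda>t. (1 - t / 2) * cos (t * y)) = (1 - cos (2 * y)) / (2 * y\<^sup>2)"
    by (simp add: integral_unique diff_divide_distrib)
  also have "1 - cos (2 * y) = 2 * (sin y)\<^sup>2"
    by (simp add: cos_double_sin)
  finally show ?thesis using False by (simp add: sinc_sq_eq)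
qed

text \<open>Differentiation under the integral sign: the y-derivative of \<open>sin_quot t y\<close>
  is cos(ty), also at t = 0, and this turns the defining integral into
  \<open>integral_cos_tent\<close>.\<close>

lemma DERIV_sinc_sq_primitive: "DERIV sinc_sq_primitive y :> sinc_sq y"
proof -
  have "((\<lambda>y. integral (cbox 0 2) (\<lambda>t. (1 - t / 2) * sin_quot t y)) has_field_derivative
      integral (cbox 0 2) (\<lambda>t. (1 - t / 2) * cos (t * y))) (at y within UNIV)"
  proof (rule leibniz_rule_field_derivative)
    show "((\<lambda>y. (1 - t / 2) * sin_quot t y) has_field_derivative (1 - t / 2) * cos (t * y))
        (at y within UNIV)" for t y :: real
      unfolding sin_quot_def by (cases "t = 0") (auto intro!: derivative_eq_intros)
    show "(\<lambda>t. (1 - t / 2) * sin_quot t y) integrable_on cbox 0 2" for y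
      unfolding cbox_interval
      by (intro integrable_continuous_real continuous_intros) auto
    show "continuous_on (UNIV \<times> cbox 0 2) (\<lambda>(y, t :: real). (1 - t / 2) * cos (t * y))"
      unfolding case_prod_beta by (intro continuous_intros) auto
  qed auto
  then show ?thesis
    by (simp add: sinc_sq_primitive_def[abs_def] integral_cos_tent)
qed

subsection \<open>Fourier inversion for the smoothed distribution function\<close>

lemma isCont_sinc_sq_primitive: "isCont sinc_sq_primitive y"
  using DERIV_sinc_sq_primitive by (rule DERIV_isCont)

lemma borel_measurable_sinc_sq_primitive [measurable]: "sinc_sq_primitive \<in> borel_measurable borel"
  by (intro borel_measurable_continuous_onI continuous_at_imp_continuous_on ballI
      isCont_sinc_sq_primitive)

lemma integrable_sinc_sq_indicator:
  "A \<in> sets borel \<Longrightarrow> integrable lborel (\<lambda>u. indicator A u * sinc_sq u)"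
  using integrable_mult_indicator[of A lborel sinc_sq] integrable_sinc_sq by simp

text \<open>Both sides are primitives of the kernel and agree at y = 0. The value of the constant
  never matters later, because it is integrated against a weight of total integral 0.\<close>

lemma sinc_sq_tail:
  "(\<integral>u. indicator {..y} u * sinc_sq u \<partial>lborel)
     = sinc_sq_primitive y + (\<integral>u. indicator {..0} u * sinc_sq u \<partial>lborel)"
proof -
  define H where "H y = (\<integral>u. indicator {..y} u * sinc_sq u \<partial>lborel)" for y :: real
  have diff: "H b - H a = sinc_sq_primitive b - sinc_sq_primitive a" if "a \<le> b" for a b
  proof -
    have "H b - H a = (\<integral>u. indicator {..b} u * sinc_sq u - indicator {..a} u * sinc_sq u \<partial>lborel)"
      unfolding H_def by (intro Bochner_Integration.integral_diff[symmetric] integrable_sinc_sq_indicator) auto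
    also have "\<dots> = (\<integral>u. sinc_sq u * indicator {a..b} u \<partial>lborel)"
    proof (rule integral_cong_AE)
      show "AE u in lborel. indicator {..b} u * sinc_sq u - indicator {..a} u * sinc_sq u
          = sinc_sq u * indicator {a..b} u"
        using AE_lborel_singleton[of a]
        by eventually_elim (use that in \<open>auto simp: indicator_def\<close>)
    qed auto
    also have "\<dots> = sinc_sq_primitive b - sinc_sq_primitive a"
      using that by (intro integral_FTC_Icc_real DERIV_sinc_sq_primitive isCont_sinc_sq)
    finally show ?thesis .
  qed
  have "sinc_sq_primitive 0 = 0" by (simp add: sinc_sq_primitive_def)
  with diff[of 0 y] diff[of y 0] have "H y = sinc_sq_primitive y + H 0"
    by linarith
  then show ?thesis by (simp add: H_def)
qed

lemma sinc_sq_primitive_LBINT: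
  "sinc_sq_primitive y = (\<integral>t. indicator {0..2} t * (1 - t / 2) * sin_quot t y \<partial>lborel)"
proof -
  have "set_integrable lborel {0..2} (\<lambda>t. (1 - t / 2) * sin_quot t y)"
    by (intro borel_integrable_atLeastAtMost' continuous_intros) auto
  from set_borel_integral_eq_integral(2)[OF this] show ?thesis
    by (simp add: sinc_sq_primitive_def set_lebesgue_integral_def mult.assoc)
qed

lemma integral_abs_bound_le:
  fixes f g :: "'a \<Rightarrow> real"
  assumes "integrable M f" "integrable M g" "\<And>x. x \<in> space M \<Longrightarrow> \<bar>f x\<bar> \<le> g x"
  shows "\<bar>\<integral>x. f x \<partial>M\<bar> \<le> (\<integral>x. g x \<partial>M)"
  by (rule order_trans[OF integral_abs_bound integral_mono]) (use assms in auto)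

lemma (in pair_sigma_finite) integrable_dominated_product:
  fixes F :: "'a \<times> 'b \<Rightarrow> real"
  assumes [measurable]: "F \<in> borel_measurable (M1 \<Otimes>\<^sub>M M2)"
    and "integrable M1 f" "integrable M2 g"
    and bound: "\<And>x y. x \<in> space M1 \<Longrightarrow> y \<in> space M2 \<Longrightarrow> \<bar>F (x, y)\<bar> \<le> f x * g y"
  shows "integrable (M1 \<Otimes>\<^sub>M M2) F"
proof (rule Bochner_Integration.integrable_bound)
  show "integrable (M1 \<Otimes>\<^sub>M M2) (\<lambda>(x, y). f x * g y)"
  proof (rule Fubini_integrable)
    note [measurable] = assms(2,3)[THEN borel_measurable_integrable]
    show "(\<lambda>(x, y). f x * g y) \<in> borel_measurable (M1 \<Otimes>\<^sub>M M2)" by measurable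
    show "integrable M1 (\<lambda>x. \<integral>y. norm ((\<lambda>(x, y). f x * g y) (x, y)) \<partial>M2)"
      using assms(2) by (simp add: abs_mult)
    show "AE x in M1. integrable M2 (\<lambda>y. (\<lambda>(x, y). f x * g y) (x, y))"
      using assms(3) by simp
  qed
  show "AE p in M1 \<Otimes>\<^sub>M M2. norm (F p) \<le> norm ((\<lambda>(x, y). f x * g y) p)"
  proof (rule AE_I2)
    fix p assume "p \<in> space (M1 \<Otimes>\<^sub>M M2)"
    then obtain x y where "p = (x, y)" "x \<in> space M1" "y \<in> space M2"
      by (auto simp: space_pair_measure)
    with bound[of x y] show "norm (F p) \<le> norm ((\<lambda>(x, y). f x * g y) p)" by simp
  qed
qed measurable

text \<open>Writing \<open>V s = \<integral>w\<cdot>1\<^bsub>Y \<le> s\<^esub> dM\<close>, this is Fourier inversion for the smoothed function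
  \<open>V * sinc\<^sup>2\<close>: the kernel has Fourier transform supported in \<open>[-2, 2]\<close>.\<close>

lemma smoothed_signed_cdf_eq:
  fixes Y w :: "'a \<Rightarrow> real"
  assumes "sigma_finite_measure M"
    and w: "integrable M w" "(\<integral>x. w x \<partial>M) = 0"
    and Y [measurable]: "Y \<in> borel_measurable M" and wY: "integrable M (\<lambda>x. w x * Y x)"
  shows "(\<integral>u. (\<integral>x. w x * indicator {..z - u} (Y x) \<partial>M) * sinc_sq u \<partial>lborel)
    = (\<integral>t. indicator {0..2} t * (1 - t / 2) * (\<integral>x. w x * sin_quot t (z - Y x) \<partial>M) \<partial>lborel)"
    (is "?L = ?R")
proof -
  interpret sigma_finite_measure M by fact
  interpret P: pair_sigma_finite M lborel by standard
  note [measurable] = borel_measurable_integrable[OF w(1)]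
  define C where "C = (\<integral>u. indicator {..0::real} u * sinc_sq u \<partial>lborel)"
  have tail: "(\<integral>u. indicator {..y} u * sinc_sq u \<partial>lborel) = sinc_sq_primitive y + C" for y
    unfolding C_def by (rule sinc_sq_tail)
  have [measurable]: "(\<lambda>p. indicator {..z - Y (fst p)} (snd p) :: real) \<in> borel_measurable (M \<Otimes>\<^sub>M lborel)"
  proof -
    have "(\<lambda>p. indicator {..z - Y (fst p)} (snd p) :: real)
        = (\<lambda>p. if snd p \<le> z - Y (fst p) then 1 else 0)"
      by (auto simp: fun_eq_iff)
    then show ?thesis by simp
  qed
  have wzY: "integrable M (\<lambda>x. w x * (z - Y x))"
    using w(1) wY by (simp add: right_diff_distrib)
  \<comment> \<open>The event Y \<le> z - u is read as a condition on u, namely u \<le> z - Y, so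
    that after Fubini the inner integral is a tail of the kernel.\<close>
  have "?L = (\<integral>u. (\<integral>x. w x * (indicator {..z - Y x} u * sinc_sq u) \<partial>M) \<partial>lborel)"
    by (subst integral_mult_left_zero[symmetric], intro Bochner_Integration.integral_cong)
       (auto simp: indicator_def)
  also have "\<dots> = (\<integral>x. (\<integral>u. w x * (indicator {..z - Y x} u * sinc_sq u) \<partial>lborel) \<partial>M)"
  proof (rule P.Fubini_integral, rule P.integrable_dominated_product)
    show "integrable M (\<lambda>x. \<bar>w x\<bar>)" using w(1) by simp
    show "integrable lborel sinc_sq" by (rule integrable_sinc_sq)
  qed (auto simp: case_prod_beta abs_mult indicator_def)
  also have "\<dots> = (\<integral>x. w x * sinc_sq_primitive (z - Y x) + w x * C \<partial>M)"
    by (simp add: tail distrib_left)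
  also have "\<dots> = (\<integral>x. w x * sinc_sq_primitive (z - Y x) \<partial>M)"
  proof -
    \<comment> \<open>Linear growth of the primitive is what integrability of
      \<open>w x * Y x\<close> can control; the constant C may then be split off and drops
      out.\<close>
    have "\<bar>sinc_sq_primitive y\<bar> \<le> 2 * \<bar>y\<bar>" for y
    proof -
      have "\<bar>sinc_sq_primitive y\<bar> \<le> (\<integral>t. indicator {0..2::real} t * \<bar>y\<bar> \<partial>lborel)"
        unfolding sinc_sq_primitive_LBINT
      proof (rule integral_abs_bound_le)
        show "integrable lborel (\<lambda>t. indicator {0..2} t * (1 - t / 2) * sin_quot t y)"
          using borel_integrable_atLeastAtMost'[of 0 2 "\<lambda>t. (1 - t / 2) * sin_quot t y"]
          by (simp add: set_integrable_def mult.assoc continuous_intros)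
        fix t :: real
        have "\<bar>1 - t / 2\<bar> * \<bar>sin_quot t y\<bar> \<le> 1 * \<bar>y\<bar>" if "t \<in> {0..2}"
          using that by (intro mult_mono abs_sin_quot_le) auto
        then show "\<bar>indicator {0..2} t * (1 - t / 2) * sin_quot t y\<bar> \<le> indicator {0..2} t * \<bar>y\<bar>"
          by (auto simp: abs_mult indicator_def)
      qed auto
      then show ?thesis by simp
    qed
    from mult_left_mono[OF this, of "\<bar>w x\<bar>" "z - Y x" for x]
    have "\<bar>w x * sinc_sq_primitive (z - Y x)\<bar> \<le> \<bar>2 * (w x * (z - Y x))\<bar>" for x
      by (simp only: abs_mult abs_numeral mult_ac abs_ge_zero)
    then have "integrable M (\<lambda>x. w x * sinc_sq_primitive (z - Y x))"
      by (intro Bochner_Integration.integrable_bound[OF integrable_mult_right[OF wzY, of 2]])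
         (simp_all del: right_diff_distrib_numeral)
    with w show ?thesis by simp
  qed
  also have "\<dots> = (\<integral>x. (\<integral>t. indicator {0..2} t * (1 - t / 2) * (w x * sin_quot t (z - Y x)) \<partial>lborel) \<partial>M)"
  proof (rule Bochner_Integration.integral_cong[OF refl])
    fix x
    have "w x * sinc_sq_primitive (z - Y x)
        = (\<integral>t. w x * (indicator {0..2} t * (1 - t / 2) * sin_quot t (z - Y x)) \<partial>lborel)"
      by (simp only: sinc_sq_primitive_LBINT integral_mult_right_zero)
    also have "\<dots> = (\<integral>t. indicator {0..2} t * (1 - t / 2) * (w x * sin_quot t (z - Y x)) \<partial>lborel)"
      by (simp only: mult.left_commute)
    finally show "w x * sinc_sq_primitive (z - Y x)
        = (\<integral>t. indicator {0..2} t * (1 - t / 2) * (w x * sin_quot t (z - Y x)) \<partial>lborel)" .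
  qed
  also have "\<dots> = (\<integral>t. (\<integral>x. indicator {0..2} t * (1 - t / 2) * (w x * sin_quot t (z - Y x)) \<partial>M) \<partial>lborel)"
  proof (rule P.Fubini_integral[symmetric], rule P.integrable_dominated_product)
    show "integrable M (\<lambda>x. \<bar>w x * (z - Y x)\<bar>)" using wzY by simp
    show "integrable lborel (\<lambda>t. indicator {0..2::real} t :: real)" by simp
    fix x and t :: real
    have "\<bar>1 - t / 2\<bar> * \<bar>sin_quot t (z - Y x)\<bar> \<le> 1 * \<bar>z - Y x\<bar>" if "t \<in> {0..2}"
      using that by (intro mult_mono abs_sin_quot_le) auto
    from mult_left_mono[OF this, of "\<bar>w x\<bar>"]
    show "\<bar>case (x, t) of (x, t) \<Rightarrow> indicator {0..2} t * (1 - t / 2) * (w x * sin_quot t (z - Y x))\<bar>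
       \<le> \<bar>w x * (z - Y x)\<bar> * indicator {0..2} t"
      by (simp add: abs_mult indicator_def mult_ac)
  qed (simp add: case_prod_beta)
  also have "\<dots> = ?R" by simp
  finally show ?thesis .
qed

text \<open>By the addition formula for the sine, the integral is the imaginary part of e^{itz}
  times the conjugate of the characteristic integral, divided by t.\<close>

lemma abs_integral_sinc_le_char:
  fixes Y w :: "'a \<Rightarrow> real"
  assumes w: "integrable M w" and Y [measurable]: "Y \<in> borel_measurable M" and "0 < t"
  shows "\<bar>\<integral>x. w x * sin_quot t (z - Y x) \<partial>M\<bar>
     \<le> cmod (\<integral>x. complex_of_real (w x) * cis (t * Y x) \<partial>M) / t"
proof -
  note [measurable] = borel_measurable_integrable[OF w]
  define I where "I = (\<integral>x. complex_of_real (w x) * cis (t * Y x) \<partial>M)"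
  have "(\<lambda>x. cis (t * Y x)) \<in> borel_measurable M"
    unfolding cis_conv_exp by measurable
  then have int: "integrable M (\<lambda>x. complex_of_real (w x) * cis (t * Y x))"
    by (intro Bochner_Integration.integrable_bound[OF w]) (auto simp: norm_mult)
  have Re: "Re I = (\<integral>x. w x * cos (t * Y x) \<partial>M)" and Im: "Im I = (\<integral>x. w x * sin (t * Y x) \<partial>M)"
    using integral_Re[OF int] integral_Im[OF int] by (simp_all add: I_def)
  have ints: "integrable M (\<lambda>x. w x * cos (t * Y x))" "integrable M (\<lambda>x. w x * sin (t * Y x))"
    using integrable_Re[OF int] integrable_Im[OF int] by simp_all
  have "w x * sin_quot t (z - Y x)
      = (sin (t * z) * (w x * cos (t * Y x)) - cos (t * z) * (w x * sin (t * Y x))) / t" for x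
    using \<open>0 < t\<close> by (simp add: sin_quot_def right_diff_distrib sin_diff field_simps)
  then have "(\<integral>x. w x * sin_quot t (z - Y x) \<partial>M) = Im (cis (t * z) * cnj I) / t"
    using ints by (simp add: Re Im)
  also have "\<bar>\<dots>\<bar> \<le> cmod I / t"
    using abs_Im_le_cmod[of "cis (t * z) * cnj I"] \<open>0 < t\<close>
    by (simp add: norm_mult divide_right_mono)
  finally show ?thesis by (simp only: I_def)
qed

lemma smoothed_signed_cdf_bound:
  fixes Y w :: "'a \<Rightarrow> real"
  assumes "sigma_finite_measure M"
    and w: "integrable M w" "(\<integral>x. w x \<partial>M) = 0"
    and Y [measurable]: "Y \<in> borel_measurable M" and wY: "integrable M (\<lambda>x. w x * Y x)"
    and \<beta>: "(\<beta> has_integral \<kappa>) {0..2}"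
    and bound: "\<And>t. 0 < t \<Longrightarrow> t \<le> 2 \<Longrightarrow>
       cmod (\<integral>x. complex_of_real (w x) * cis (t * Y x) \<partial>M) / t \<le> \<beta> t"
  shows "\<bar>\<integral>u. (\<integral>x. w x * indicator {..z - u} (Y x) \<partial>M) * sinc_sq u \<partial>lborel\<bar> \<le> \<kappa>"
proof -
  interpret sigma_finite_measure M by fact
  note [measurable] = borel_measurable_integrable[OF w(1)]
  define G where "G t = (\<integral>x. w x * sin_quot t (z - Y x) \<partial>M)" for t
  have [measurable]: "G \<in> borel_measurable borel"
    unfolding G_def by measurable
  \<comment> \<open>A bound uniform in t, so that the tent times \<open>G\<close> is integrable over
    the compact frequency range.\<close>
  have G_le: "\<bar>G t\<bar> \<le> (\<integral>x. \<bar>w x * (z - Y x)\<bar> \<partial>M)" for t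
    unfolding G_def
  proof (rule integral_abs_bound_le)
    have wzY: "integrable M (\<lambda>x. w x * (z - Y x))"
      using w(1) wY by (simp add: right_diff_distrib)
    then show "integrable M (\<lambda>x. \<bar>w x * (z - Y x)\<bar>)" by simp
    have *: "\<bar>w x * sin_quot t (z - Y x)\<bar> \<le> \<bar>w x * (z - Y x)\<bar>" for x
      using mult_left_mono[OF abs_sin_quot_le, of "\<bar>w x\<bar>" t "z - Y x"] by (simp add: abs_mult)
    then show "integrable M (\<lambda>x. w x * sin_quot t (z - Y x))"
      by (intro Bochner_Integration.integrable_bound[OF wzY]) auto
    show "\<bar>w x * sin_quot t (z - Y x)\<bar> \<le> \<bar>w x * (z - Y x)\<bar>" for x by (rule *)
  qed
  have G_int: "set_integrable lborel {0..2} (\<lambda>t. (1 - t / 2) * G t)"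
    unfolding set_integrable_def
  proof (rule Bochner_Integration.integrable_bound)
    show "integrable lborel (\<lambda>t. indicator {0..2::real} t * (\<integral>x. \<bar>w x * (z - Y x)\<bar> \<partial>M))" by simp
    have "\<bar>1 - t / 2\<bar> * \<bar>G t\<bar> \<le> 1 * (\<integral>x. \<bar>w x * (z - Y x)\<bar> \<partial>M)" if "t \<in> {0..2}" for t
      using that by (intro mult_mono G_le) auto
    then show "AE t in lborel. norm (indicat_real {0..2} t *\<^sub>R ((1 - t / 2) * G t))
        \<le> norm (indicat_real {0..2} t * (\<integral>x. \<bar>w x * (z - Y x)\<bar> \<partial>M))"
      by (auto simp: indicator_def abs_mult)
  qed auto
  have "(\<integral>u. (\<integral>x. w x * indicator {..z - u} (Y x) \<partial>M) * sinc_sq u \<partial>lborel)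
      = (LBINT t:{0..2}. (1 - t / 2) * G t)"
    by (subst smoothed_signed_cdf_eq[OF assms(1-5)])
       (simp add: G_def set_lebesgue_integral_def mult.assoc)
  also have "\<dots> = integral {0..2} (\<lambda>t. (1 - t / 2) * G t)"
    by (rule set_borel_integral_eq_integral(2)[OF G_int])
  \<comment> \<open>The endpoint 0 is removed because the majorant \<beta> is only assumed to
    dominate for t > 0.\<close>
  also have "\<dots> = integral {0<..2} (\<lambda>t. (1 - t / 2) * G t)"
    by (rule integral_spike_set; rule negligible_subset[of "{0}"]) auto
  finally have eq: "(\<integral>u. (\<integral>x. w x * indicator {..z - u} (Y x) \<partial>M) * sinc_sq u \<partial>lborel)
      = integral {0<..2} (\<lambda>t. (1 - t / 2) * G t)" .
  have \<beta>': "(\<beta> has_integral \<kappa>) {0<..2}"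
    by (rule has_integral_spike_set_eq[THEN iffD1, OF _ _ \<beta>]; rule negligible_subset[of "{0}"]) auto
  have intg: "(\<lambda>t. (1 - t / 2) * G t) integrable_on {0<..2}"
    by (rule integrable_spike_set[OF set_borel_integral_eq_integral(1)[OF G_int]]; rule negligible_subset[of "{0}"]) auto
  have "norm (integral {0<..2} (\<lambda>t. (1 - t / 2) * G t)) \<le> integral {0<..2} \<beta>"
  proof (rule Henstock_Kurzweil_Integration.integral_norm_bound_integral[OF intg])
    show "\<beta> integrable_on {0<..2}" using \<beta>' by blast
    fix t :: real assume t: "t \<in> {0<..2}"
    have "\<bar>1 - t / 2\<bar> * \<bar>G t\<bar> \<le> 1 * \<bar>G t\<bar>"
      using t by (intro mult_right_mono) auto
    also have "\<bar>G t\<bar> \<le> \<beta> t"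
      using abs_integral_sinc_le_char[OF w(1) Y, of t z] bound[of t] t by (simp add: G_def)
    finally show "norm ((1 - t / 2) * G t) \<le> \<beta> t" by (simp add: abs_mult)
  qed
  then show ?thesis using \<beta>' by (simp add: eq integral_unique)
qed

subsection \<open>Smoothing inequality\<close>

text \<open>The smoothed function is evaluated at \<open>x + c/2\<close>, so that the window \<open>\<bar>u\<bar> \<le> c/2\<close> only sees points to
  the right of \<open>x\<close>, where \<open>V\<close> cannot have dropped by much.\<close>

lemma smoothing_upper:
  assumes [measurable]: "V \<in> borel_measurable borel"
    and V: "\<And>x. \<bar>V x\<bar> \<le> \<Delta>"
    and drop: "\<And>x s. 0 \<le> s \<Longrightarrow> V x - (\<alpha> + L * s) \<le> V (x + s)"
    and nonneg: "0 \<le> \<alpha>" "0 \<le> L"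
    and smooth: "\<And>z. (\<integral>u. V (z - u) * sinc_sq u \<partial>lborel) \<le> \<kappa>"
  shows "V x * (pi / 2 + 1 / 4)
    \<le> \<kappa> + smoothing_const * (\<alpha> + L * smoothing_const / 2) + \<Delta> * (pi / 2 - 1 / 4)"
proof -
  define h where "h = smoothing_const / 2"
  have h: "0 < h" using smoothing_const_pos by (simp add: h_def)
  define W where "W u = indicator {-h..h} u * sinc_sq u" for u
  have W: "has_bochner_integral lborel W (pi / 2 + 1 / 4)"
    using has_bochner_integral_sinc_sq_window by (simp add: W_def[abs_def] h_def)
  then have W_int: "integrable lborel W" and W_val: "(\<integral>u. W u \<partial>lborel) = pi / 2 + 1 / 4"
    by (auto simp: has_bochner_integral_iff)
  note [measurable] = borel_measurable_integrable[OF W_int]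
  \<comment> \<open>The kernel is at most 1 and the window has length c, so its mass pi/2 + 1/4 is
    at most c. This produces the factor c in the final bound.\<close>
  have "(\<integral>u. W u \<partial>lborel) \<le> (\<integral>u. indicator {-h..h} u \<partial>lborel)"
    using h by (intro integral_mono W_int) (auto simp: W_def sinc_sq_le_1 intro: mult_left_le)
  also have "\<dots> = smoothing_const" using h by (simp add: h_def)
  finally have W_le: "pi / 2 + 1 / 4 \<le> smoothing_const" using W_val by simp
  have uW_int: "integrable lborel (\<lambda>u. u * W u)"
  proof (rule Bochner_Integration.integrable_bound)
    show "integrable lborel (\<lambda>u. h * W u)" using W_int by simp
    show "AE u in lborel. norm (u * W u) \<le> norm (h * W u)"
      by (auto simp: W_def indicator_def abs_mult intro!: mult_right_mono)
  qed simp
  \<comment> \<open>The first moment of the even function \<open>W\<close> vanishes, so the linear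
    loss L (h - u) averages to L h over the window.\<close>
  have "has_bochner_integral lborel (\<lambda>u. u * W u) 0"
  proof (rule has_bochner_integral_odd_function)
    show "has_bochner_integral lborel (\<lambda>u. indicator {0..} u *\<^sub>R (u * W u))
        (\<integral>u. indicator {0..} u *\<^sub>R (u * W u) \<partial>lborel)"
      by (intro has_bochner_integral_integrable integrable_mult_indicator uW_int) auto
    show "- u * W (- u) = - (u * W u)" for u
      by (auto simp: W_def indicator_def)
  qed
  then have uW_val: "(\<integral>u. u * W u \<partial>lborel) = 0" by (simp add: has_bochner_integral_iff)
  \<comment> \<open>A pointwise minorant of V(x + h - u) times the kernel. In the window h - u \<ge>
    0, so \<open>drop\<close> applies with s = h - u; outside it only -\<Delta> is available, with
    kernel mass pi/2 - 1/4.\<close>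
  define lower where "lower u = (V x - \<alpha> - L * h) * W u + L * (u * W u) - \<Delta> * (sinc_sq u - W u)" for u
  have "(V x - \<alpha> - L * h) * (pi / 2 + 1 / 4) - \<Delta> * (pi - (pi / 2 + 1 / 4)) = (\<integral>u. lower u \<partial>lborel)"
    using W_int uW_int integrable_sinc_sq
    by (simp add: lower_def W_val uW_val integral_sinc_sq)
  also have "\<dots> \<le> (\<integral>u. V (x + h - u) * sinc_sq u \<partial>lborel)"
  proof (rule integral_mono)
    show "integrable lborel lower"
      using W_int uW_int integrable_sinc_sq by (simp add: lower_def[abs_def])
    show "integrable lborel (\<lambda>u. V (x + h - u) * sinc_sq u)"
    proof (rule Bochner_Integration.integrable_bound)
      show "integrable lborel (\<lambda>u. \<Delta> * sinc_sq u)" using integrable_sinc_sq by simp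
      have "\<bar>V (x + h - u)\<bar> * sinc_sq u \<le> \<bar>\<Delta>\<bar> * sinc_sq u" for u
        using V[of "x + h - u"] by (intro mult_right_mono) auto
      then show "AE u in lborel. norm (V (x + h - u) * sinc_sq u) \<le> norm (\<Delta> * sinc_sq u)"
        by (simp add: abs_mult)
    qed measurable
    fix u
    show "lower u \<le> V (x + h - u) * sinc_sq u"
    proof (cases "u \<in> {-h..h}")
      case True
      then have "lower u = (V x - (\<alpha> + L * (h - u))) * sinc_sq u"
        by (simp add: lower_def W_def algebra_simps)
      also have "\<dots> \<le> V (x + (h - u)) * sinc_sq u"
        using True by (intro mult_right_mono drop) auto
      finally show ?thesis by (simp add: add_diff_eq)
    next
      case False
      then have "lower u = - \<Delta> * sinc_sq u"
        by (simp add: lower_def W_def)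
      also have "\<dots> \<le> V (x + h - u) * sinc_sq u"
        using V[of "x + h - u"] by (intro mult_right_mono) auto
      finally show ?thesis .
    qed
  qed
  also have "\<dots> \<le> \<kappa>" by (rule smooth)
  finally have "V x * (pi / 2 + 1 / 4) \<le> \<kappa> + (pi / 2 + 1 / 4) * (\<alpha> + L * h) + \<Delta> * (pi / 2 - 1 / 4)"
    by (simp add: algebra_simps)
  moreover have "(pi / 2 + 1 / 4) * (\<alpha> + L * h) \<le> smoothing_const * (\<alpha> + L * h)"
    using W_le nonneg h by (intro mult_right_mono) auto
  ultimately show ?thesis by (simp add: h_def)
qed

text \<open>The window of \<open>smoothing_upper\<close> carries \<open>\<pi>/2 + 1/4\<close> of the total mass \<open>\<pi>\<close> of the kernel, so
  taking suprema leaves the factor \<open>1/2\<close> in front of \<open>sup \<bar>V\<bar>\<close>.\<close>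

lemma smoothing_bound:
  assumes [measurable]: "V \<in> borel_measurable borel"
    and bdd: "\<And>x. \<bar>V x\<bar> \<le> D"
    and drop: "\<And>x s. 0 \<le> s \<Longrightarrow> V x - (\<alpha> + L * s) \<le> V (x + s)"
    and nonneg: "0 \<le> \<alpha>" "0 \<le> L"
    and smooth: "\<And>z. \<bar>\<integral>u. V (z - u) * sinc_sq u \<partial>lborel\<bar> \<le> \<kappa>"
  shows "\<bar>V x\<bar> \<le> 2 * \<kappa> + smoothing_const * (2 * \<alpha> + L * smoothing_const)"
proof -
  \<comment> \<open>The estimate is self-improving, so it is run with the supremum itself; the bound
    D only ensures that this supremum is finite.\<close>
  define \<Delta> where "\<Delta> = (SUP x. \<bar>V x\<bar>)"
  have "bdd_above (range (\<lambda>x. \<bar>V x\<bar>))" using bdd by (intro bdd_aboveI2)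
  then have V: "\<bar>V x\<bar> \<le> \<Delta>" for x unfolding \<Delta>_def by (rule cSUP_upper[OF UNIV_I])
  define E where "E = \<kappa> + smoothing_const * (\<alpha> + L * smoothing_const / 2) + \<Delta> * (pi / 2 - 1 / 4)"
  have "V x * (pi / 2 + 1 / 4) \<le> E" for x
    unfolding E_def using smooth by (intro smoothing_upper V drop nonneg) (auto simp: abs_le_iff)
  \<comment> \<open>The reflected function x \<mapsto> -V(-x) satisfies the same one-sided drop
    condition, and the kernel is even, so the upper bound for it is the lower bound for V.\<close>
  moreover have "- V (- x) * (pi / 2 + 1 / 4) \<le> E" for x
    unfolding E_def
  proof (rule smoothing_upper[where V = "\<lambda>x. - V (- x)"])
    show "- V (- x) - (\<alpha> + L * s) \<le> - V (- (x + s))" if "0 \<le> s" for x s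
      using drop[OF that, of "- x - s"] by simp
    show "(\<integral>u. - V (- (z - u)) * sinc_sq u \<partial>lborel) \<le> \<kappa>" for z
      using smooth[of "- z"] lborel_integral_real_affine[of "-1" "\<lambda>u. V (- z - u) * sinc_sq u" 0]
      by (simp add: abs_le_iff add.commute)
  qed (use V nonneg in auto)
  from this[of "- x" for x] have "- V x * (pi / 2 + 1 / 4) \<le> E" for x by simp
  ultimately have "\<bar>V x\<bar> * (pi / 2 + 1 / 4) \<le> E" for x
    by (simp add: abs_if)
  then have "\<bar>V x\<bar> \<le> E / (pi / 2 + 1 / 4)" for x
    by (subst pos_le_divide_eq) (auto intro: add_pos_pos)
  then have "\<Delta> \<le> E / (pi / 2 + 1 / 4)"
    unfolding \<Delta>_def by (intro cSUP_least) auto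
  then have "\<Delta> * (pi / 2 + 1 / 4) \<le> E"
    by (subst (asm) pos_le_divide_eq) (auto intro: add_pos_pos)
  then have "\<Delta> \<le> 2 * \<kappa> + smoothing_const * (2 * \<alpha> + L * smoothing_const)"
    by (simp add: E_def algebra_simps)
  with V[of x] show ?thesis by linarith
qed

section \<open>Kolmogorov distance, densities and increments of distribution functions\<close>

lemma kolmogorov_dist_upper:
  assumes "prob_space M" "prob_space N"
  shows "\<bar>measure M {x \<in> space M. X x \<le> t} - measure N {y \<in> space N. Y y \<le> t}\<bar>
    \<le> kolmogorov_dist M X N Y"
  unfolding kolmogorov_dist_def
proof (rule cSUP_upper[OF UNIV_I])
  interpret M: prob_space M by fact
  interpret N: prob_space N by fact
  show "bdd_above (range (\<lambda>t. \<bar>measure M {x \<in> space M. X x \<le> t} - measure N {y \<in> space N. Y y \<le> t}\<bar>))"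
  proof (rule bdd_aboveI2)
    show "\<bar>measure M A - measure N A'\<bar> \<le> 1" for A A'
      using M.prob_le_1[of A] N.prob_le_1[of A'] measure_nonneg[of M A] measure_nonneg[of N A'] by linarith
  qed
qed

lemma kolmogorov_dist_le:
  assumes "\<And>t. \<bar>measure M {x \<in> space M. X x \<le> t} - measure N {y \<in> space N. Y y \<le> t}\<bar> \<le> K"
  shows "kolmogorov_dist M X N Y \<le> K"
  unfolding kolmogorov_dist_def using assms by (intro cSUP_least) auto

lemma measure_density_eq_integral:
  assumes r: "integrable M r" "\<And>x. x \<in> space M \<Longrightarrow> 0 \<le> r x" and A [measurable]: "A \<in> sets M"
  shows "measure (density M (\<lambda>x. ennreal (r x))) A = (\<integral>x. r x * indicator A x \<partial>M)"
proof -
  note [measurable] = borel_measurable_integrable[OF r(1)]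
  have "measure (density M (\<lambda>x. ennreal (r x))) A
      = (\<integral>x. indicator A x \<partial>density M (\<lambda>x. ennreal (r x)))"
    using sets.sets_into_space[OF A] by (simp add: Int_absorb2)
  also have "\<dots> = (\<integral>x. r x *\<^sub>R indicator A x \<partial>M)"
    using r(2) by (intro integral_density) auto
  finally show ?thesis by simp
qed

lemma prob_space_density_integral:
  assumes "integrable M r" "\<And>x. x \<in> space M \<Longrightarrow> 0 \<le> r x" "(\<integral>x. r x \<partial>M) = 1"
  shows "prob_space (density M (\<lambda>x. ennreal (r x)))"
proof (rule prob_spaceI)
  have "emeasure (density M (\<lambda>x. ennreal (r x))) (space (density M (\<lambda>x. ennreal (r x))))
      = (\<integral>\<^sup>+x. ennreal (r x) \<partial>M)"
    using assms(1) by (auto simp: emeasure_density borel_measurable_integrable intro!: nn_integral_cong)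
  also have "\<dots> = ennreal (\<integral>x. r x \<partial>M)"
    using assms(1,2) by (intro nn_integral_eq_integral) auto
  finally show "emeasure (density M (\<lambda>x. ennreal (r x))) (space (density M (\<lambda>x. ennreal (r x)))) = 1"
    using assms(3) by simp
qed

lemma cdf_increment_le_of_density_le:
  assumes "prob_space N" and Z: "distributed N lborel Z (\<lambda>t. ennreal (f t))"
    and f: "\<And>t. f t \<le> L" "0 \<le> L" and "0 \<le> s"
  shows "measure N {y \<in> space N. Z y \<le> t + s} \<le> measure N {y \<in> space N. Z y \<le> t} + L * s"
proof -
  interpret N: prob_space N by fact
  note [measurable] = distributed_measurable[OF Z, simplified]
  have "emeasure N (Z -` {t<..t + s} \<inter> space N) = (\<integral>\<^sup>+x. ennreal (f x) * indicator {t<..t + s} x \<partial>lborel)"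
    by (rule distributed_emeasure[OF Z]) simp
  also have "\<dots> \<le> (\<integral>\<^sup>+x. ennreal L * indicator {t<..t + s} x \<partial>lborel)"
    using f(1) by (intro nn_integral_mono mult_right_mono ennreal_leI) auto
  also have "\<dots> = ennreal (L * s)"
    using \<open>0 \<le> s\<close> f(2) by (simp add: nn_integral_cmult_indicator ennreal_mult)
  finally have le: "measure N (Z -` {t<..t + s} \<inter> space N) \<le> L * s"
    using \<open>0 \<le> s\<close> f(2) by (simp add: N.emeasure_eq_measure)
  have "measure N {y \<in> space N. Z y \<le> t + s}
      \<le> measure N ({y \<in> space N. Z y \<le> t} \<union> (Z -` {t<..t + s} \<inter> space N))"
    by (rule N.finite_measure_mono) auto
  also have "\<dots> \<le> measure N {y \<in> space N. Z y \<le> t} + measure N (Z -` {t<..t + s} \<inter> space N)"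
    by (rule measure_Un_le) auto
  finally show ?thesis using le by linarith
qed

text \<open>Esseen's smoothing inequality, except that no regularity of \<open>W\<close> itself is assumed: its
  distribution function under \<open>M\<close> has increments at most \<open>2 d + L s\<close>, where \<open>d\<close> is the distance
  to \<open>Z\<close>.\<close>

lemma kolmogorov_dist_density_le:
  fixes W :: "'a \<Rightarrow> real" and Z :: "'b \<Rightarrow> real"
  assumes M: "prob_space M" and N: "prob_space N"
    and r: "integrable M r" "\<And>x. x \<in> space M \<Longrightarrow> 0 \<le> r x" "(\<integral>x. r x \<partial>M) = 1"
    and W [measurable]: "W \<in> borel_measurable M" and rW: "integrable M (\<lambda>x. (r x - 1) * W x)"
    and Z: "distributed N lborel Z (\<lambda>t. ennreal (f t))" and f: "\<And>t. f t \<le> L" "0 \<le> L"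
    and "0 < a"
    and \<beta>: "(\<beta> has_integral \<kappa>) {0..2}"
    and char: "\<And>t. 0 < t \<Longrightarrow> t \<le> 2 \<Longrightarrow>
       cmod (\<integral>x. complex_of_real (r x - 1) * cis (t * (a * W x)) \<partial>M) / t \<le> \<beta> t"
  shows "kolmogorov_dist (density M (\<lambda>x. ennreal (r x))) W N Z
    \<le> (4 * smoothing_const + 1) * kolmogorov_dist M W N Z + 2 * \<kappa> + L * smoothing_const\<^sup>2 / a"
proof (rule kolmogorov_dist_le)
  interpret prob_space M by fact
  note [measurable] = borel_measurable_integrable[OF r(1)]
  define \<nu> where "\<nu> = density M (\<lambda>x. ennreal (r x))"
  have \<nu>: "prob_space \<nu>" unfolding \<nu>_def by (rule prob_space_density_integral[OF r])
  interpret \<nu>: prob_space \<nu> by fact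
  have [simp]: "space \<nu> = space M" and sets_\<nu> [measurable_cong]: "sets \<nu> = sets M"
    by (simp_all add: \<nu>_def)
  define d where "d = kolmogorov_dist M W N Z"
  define F where "F t = measure \<nu> {x \<in> space M. W x \<le> t}" for t
  define G where "G t = measure M {x \<in> space M. W x \<le> t}" for t
  define P where "P t = measure N {y \<in> space N. Z y \<le> t}" for t
  have d: "\<bar>G t - P t\<bar> \<le> d" for t
    unfolding G_def P_def d_def by (rule kolmogorov_dist_upper[OF M N])
  have "0 \<le> d" using d[of 0] by linarith
  \<comment> \<open>The kernel has the fixed cutoff frequency 2, so the variable is rescaled to a W
    instead. A Lipschitz constant L in the original scale becomes L / a.\<close>
  define V where "V s = (\<integral>x. (r x - 1) * indicator {..s} (a * W x) \<partial>M)" for s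
  have V_eq: "V s = F (s / a) - G (s / a)" for s
  proof -
    have ind: "indicator {..s} (a * W x) = (indicator {x \<in> space M. W x \<le> s / a} x :: real)"
      if "x \<in> space M" for x
      using that \<open>0 < a\<close> by (simp add: indicator_def field_simps)
    have "V s = (\<integral>x. r x * indicator {x \<in> space M. W x \<le> s / a} x - indicator {x \<in> space M. W x \<le> s / a} x \<partial>M)"
      unfolding V_def by (intro Bochner_Integration.integral_cong) (auto simp: ind left_diff_distrib)
    also have "\<dots> = (\<integral>x. r x * indicator {x \<in> space M. W x \<le> s / a} x \<partial>M)
        - (\<integral>x. indicator {x \<in> space M. W x \<le> s / a} x \<partial>M)"
      by (intro Bochner_Integration.integral_diff integrable_real_mult_indicator r
          integrable_const_bound[of _ 1]) (auto simp: indicator_def)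
    also have "(\<integral>x. r x * indicator {x \<in> space M. W x \<le> s / a} x \<partial>M) = F (s / a)"
      unfolding F_def \<nu>_def by (rule measure_density_eq_integral[symmetric, OF r(1,2)]) auto
    finally show ?thesis by (simp add: G_def)
  qed
  \<comment> \<open>Replacing G by the distribution function of Z costs d at each of the two
    endpoints, hence 2 d. As F is monotone, V = F - G can drop only by such an increase of
    G.\<close>
  have G_incr: "G (t + s) \<le> G t + (2 * d + L * s)" if "0 \<le> s" for t s
    using cdf_increment_le_of_density_le[OF N Z f that, of t, folded P_def] d[of t] d[of "t + s"]
    by linarith
  have F_mono: "F t \<le> F (t + s)" if "0 \<le> s" for t s
    unfolding F_def using that by (intro \<nu>.finite_measure_mono) (auto simp: sets_\<nu>)
  have "\<bar>V x\<bar> \<le> 2 * \<kappa> + smoothing_const * (2 * (2 * d) + (L / a) * smoothing_const)" for x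
  proof (rule smoothing_bound[where V = V and D = 1])
    have "V = (\<lambda>s. \<integral>x. (if a * W x \<le> s then r x - 1 else 0) \<partial>M)"
      by (auto simp: V_def fun_eq_iff intro!: Bochner_Integration.integral_cong)
    also have "\<dots> \<in> borel_measurable borel" by measurable
    finally show "V \<in> borel_measurable borel" .
    show "\<bar>V x\<bar> \<le> 1" for x
      using measure_nonneg[of M] measure_nonneg[of \<nu>] prob_le_1 \<nu>.prob_le_1
      unfolding V_eq F_def G_def by (smt (verit))
    show "V x - (2 * d + L / a * s) \<le> V (x + s)" if "0 \<le> s" for x s
      using G_incr[of "s / a" "x / a"] F_mono[of "s / a" "x / a"] that \<open>0 < a\<close>
      by (simp add: V_eq add_divide_distrib)
    show "0 \<le> 2 * d" "0 \<le> L / a" using \<open>0 \<le> d\<close> \<open>0 < a\<close> f(2) by simp_all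
    show "\<bar>\<integral>u. V (z - u) * sinc_sq u \<partial>lborel\<bar> \<le> \<kappa>" for z
      unfolding V_def
    proof (rule smoothed_signed_cdf_bound[OF _ _ _ _ _ \<beta> char])
      show "sigma_finite_measure M" by unfold_locales
      show "integrable M (\<lambda>x. r x - 1)" using r(1) by simp
      show "(\<integral>x. r x - 1 \<partial>M) = 0" using r(1,3) by (simp add: prob_space)
      show "integrable M (\<lambda>x. (r x - 1) * (a * W x))"
        using integrable_mult_right[OF rW, of a] by (simp only: mult.left_commute)
    qed auto
  qed
  from this[of "a * t" for t]
  have FG: "\<bar>F t - G t\<bar> \<le> 2 * \<kappa> + smoothing_const * (4 * d + (L / a) * smoothing_const)" for t
    using \<open>0 < a\<close> by (simp add: V_eq)
  fix t
  \<comment> \<open>The drop parameter 2 d has become 4 c d in the bound for F - G; the passage from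
    G to P adds one more d.\<close>
  have "\<bar>F t - P t\<bar> \<le> 2 * \<kappa> + smoothing_const * (4 * d + (L / a) * smoothing_const) + d"
    using FG[of t] d[of t] by linarith
  also have "\<dots> = (4 * smoothing_const + 1) * d + 2 * \<kappa> + L * smoothing_const\<^sup>2 / a"
    by (simp add: algebra_simps power2_eq_square)
  finally show "\<bar>measure (density M (\<lambda>x. ennreal (r x))) {x \<in> space (density M (\<lambda>x. ennreal (r x))). W x \<le> t}
      - measure N {y \<in> space N. Z y \<le> t}\<bar>
      \<le> (4 * smoothing_const + 1) * kolmogorov_dist M W N Z + 2 * \<kappa> + L * smoothing_const\<^sup>2 / a"
    by (simp add: F_def P_def d_def \<nu>_def)
qed

subsection \<open>Characteristic functions under decay of correlations\<close>

lemma cmod_cis_minus_1_le: "cmod (cis x - 1) \<le> \<bar>x\<bar>"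
  using iexp_approx1[of x 0] by (simp add: cis_conv_exp)

lemma borel_measurable_cis [measurable]: "cis \<in> borel_measurable borel"
  unfolding cis_conv_exp[abs_def] by measurable

text \<open>Since |e^{iA} - 1| \<le> |A|, the phase A can be removed at the cost of its weighted
  first moment. It is applied with A coming from the first \<rho> summands, and with A the whole
  phase and R = 0.\<close>

lemma char_perturbation:
  fixes w A R :: "'a \<Rightarrow> real"
  assumes w: "integrable M w"
    and [measurable]: "A \<in> borel_measurable M" "R \<in> borel_measurable M"
    and wA: "integrable M (\<lambda>x. w x * A x)"
  shows "cmod (\<integral>x. complex_of_real (w x) * cis (A x + R x) \<partial>M)
    \<le> (\<integral>x. \<bar>w x * A x\<bar> \<partial>M) + cmod (\<integral>x. complex_of_real (w x) * cis (R x) \<partial>M)"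
proof -
  note [measurable] = borel_measurable_integrable[OF w]
  have int: "integrable M (\<lambda>x. complex_of_real (w x) * cis (f x))"
    if [measurable]: "f \<in> borel_measurable M" for f
    by (rule Bochner_Integration.integrable_bound[OF w]) (auto simp: norm_mult)
  have "(\<integral>x. complex_of_real (w x) * cis (A x + R x) \<partial>M) - (\<integral>x. complex_of_real (w x) * cis (R x) \<partial>M)
      = (\<integral>x. complex_of_real (w x) * cis (A x + R x) - complex_of_real (w x) * cis (R x) \<partial>M)"
    by (intro Bochner_Integration.integral_diff[symmetric] int) measurable
  also have "cmod \<dots> \<le> (\<integral>x. cmod (complex_of_real (w x) * cis (A x + R x) - complex_of_real (w x) * cis (R x)) \<partial>M)"
    by (rule integral_norm_bound)
  also have "\<dots> \<le> (\<integral>x. \<bar>w x * A x\<bar> \<partial>M)"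
  proof (rule integral_mono)
    show "integrable M (\<lambda>x. cmod (complex_of_real (w x) * cis (A x + R x) - complex_of_real (w x) * cis (R x)))"
      by (intro integrable_norm Bochner_Integration.integrable_diff int) measurable
    show "integrable M (\<lambda>x. \<bar>w x * A x\<bar>)" using wA by simp
    fix x
    have "complex_of_real (w x) * cis (A x + R x) - complex_of_real (w x) * cis (R x)
        = complex_of_real (w x) * ((cis (A x) - 1) * cis (R x))"
      by (simp add: cis_mult[symmetric] algebra_simps)
    then show "cmod (complex_of_real (w x) * cis (A x + R x) - complex_of_real (w x) * cis (R x)) \<le> \<bar>w x * A x\<bar>"
      by (simp add: norm_mult abs_mult cmod_cis_minus_1_le mult_left_mono)
  qed
  finally show ?thesis
    using norm_triangle_sub[of "\<integral>x. complex_of_real (w x) * cis (A x + R x) \<partial>M"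
        "\<integral>x. complex_of_real (w x) * cis (R x) \<partial>M"] by linarith
qed

section \<open>Tails of the process and Birkhoff sums\<close>

lemma measurable_tail_map:
  assumes "\<And>j. X j \<in> measurable M (Xs j)"
  shows "tail_map X n \<in> measurable M (tail_space Xs n)"
  unfolding tail_map_def[abs_def] tail_space_def
  using assms by (intro measurable_PiM_single') (auto intro: measurable_space)

lemma measurable_tail_shift:
  "(\<lambda>w k. w (m + k)) \<in> measurable (tail_space Xs n) (tail_space Xs (n + m))"
  unfolding tail_space_def
  by (rule measurable_PiM_single') (auto simp: space_PiM PiE_iff add.assoc)

lemma measurable_birkhoff_sum:
  assumes "\<And>j. X j \<in> measurable M (Xs j)" and "\<And>j. g j \<in> borel_measurable (tail_space Xs j)"
  shows "birkhoff_sum X g n \<in> borel_measurable M"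
  unfolding birkhoff_sum_def[abs_def]
  by (intro borel_measurable_sum measurable_compose[OF measurable_tail_map assms(2)] assms(1))

text \<open>For j \<ge> m the tail from j is the tail from m shifted by j - m. The remaining
  summands are thus one function of the tail from m, as the decay assumption demands of its test
  functions.\<close>

lemma birkhoff_sum_split:
  assumes "\<And>j. g j \<in> borel_measurable (tail_space Xs j)" and "m \<le> n"
  obtains h where "h \<in> borel_measurable (tail_space Xs m)"
    and "\<And>x. birkhoff_sum X g n x = birkhoff_sum X g m x + h (tail_map X m x)"
proof
  define h where "h w = (\<Sum>j=m..<n. g j (\<lambda>k. w (j - m + k)))" for w
  show "h \<in> borel_measurable (tail_space Xs m)"
    unfolding h_def
  proof (rule borel_measurable_sum)
    fix j assume "j \<in> {m..<n}"
    with measurable_tail_shift[of "j - m" Xs m]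
    have "(\<lambda>w k. w (j - m + k)) \<in> measurable (tail_space Xs m) (tail_space Xs j)" by simp
    from measurable_compose[OF this assms(1)]
    show "(\<lambda>w. g j (\<lambda>k. w (j - m + k))) \<in> borel_measurable (tail_space Xs m)" .
  qed
  fix x
  have "h (tail_map X m x) = (\<Sum>j=m..<n. g j (tail_map X j x))"
    unfolding h_def by (intro sum.cong refl arg_cong[of _ _ "g _"]) (auto simp: tail_map_def fun_eq_iff)
  moreover have "(\<Sum>j<n. g j (tail_map X j x)) = (\<Sum>j<m. g j (tail_map X j x)) + (\<Sum>j=m..<n. g j (tail_map X j x))"
    using \<open>m \<le> n\<close> sum.atLeastLessThan_concat[of 0 m n "\<lambda>j. g j (tail_map X j x)"]
    by (simp add: atLeast0LessThan)
  ultimately show "birkhoff_sum X g n x = birkhoff_sum X g m x + h (tail_map X m x)"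
    by (simp add: birkhoff_sum_def)
qed

text \<open>The test function e^{iuh} has modulus 1, hence essential norm 1, and since r has
  integral 1 the covariance in the decay assumption is the integral against r - 1.\<close>

lemma decay_of_correlations_cis:
  assumes "prob_space M" and X: "\<And>j. X j \<in> measurable M (Xs j)"
    and DC: "decay_of_correlations M Xs X B nrm \<delta>" and "r \<in> B" and r: "(\<integral>x. r x \<partial>M) = 1"
    and h [measurable]: "h \<in> borel_measurable (tail_space Xs m)"
  shows "cmod (\<integral>x. complex_of_real (r x - 1) * cis (u * h (tail_map X m x)) \<partial>M) \<le> nrm r * \<delta> m"
proof -
  interpret prob_space M by fact
  define f where "f w = cis (u * h w)" for w
  have [measurable]: "f \<in> borel_measurable (tail_space Xs m)" unfolding f_def by measurable
  have fX [measurable]: "(\<lambda>x. f (tail_map X m x)) \<in> borel_measurable M"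
    by (rule measurable_compose[OF measurable_tail_map]) (use X in auto)
  have norm_f: "cmod (f w) = 1" for w by (simp add: f_def)
  then have "bounded (f ` space (tail_space Xs m))" by (intro boundedI[of _ 1]) auto
  then have *: "cmod ((\<integral>x. complex_of_real (r x) * f (tail_map X m x) \<partial>M)
        - complex_of_real (\<integral>x. r x \<partial>M) * (\<integral>x. f (tail_map X m x) \<partial>M))
      \<le> nrm r * ess_norm M (\<lambda>x. f (tail_map X m x)) * \<delta> m"
    using DC \<open>r \<in> B\<close> unfolding decay_of_correlations_def by auto
  have "ess_norm M (\<lambda>x. f (tail_map X m x)) = 1"
    by (simp add: ess_norm_def norm_f esssup_const emeasure_space_1)
  moreover have "(\<integral>x. complex_of_real (r x - 1) * f (tail_map X m x) \<partial>M)
      = (\<integral>x. complex_of_real (r x) * f (tail_map X m x) \<partial>M) - (\<integral>x. f (tail_map X m x) \<partial>M)"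
  proof -
    have r_int: "integrable M r"
      using DC \<open>r \<in> B\<close> by (auto simp: decay_of_correlations_def)
    note [measurable] = borel_measurable_integrable[OF r_int]
    have "integrable M (\<lambda>x. complex_of_real (r x) * f (tail_map X m x))"
      by (rule Bochner_Integration.integrable_bound[OF r_int]) (auto simp: norm_mult norm_f)
    moreover have "integrable M (\<lambda>x. f (tail_map X m x))"
      by (rule integrable_const_bound[of _ 1]) (auto simp: norm_f)
    ultimately show ?thesis by (simp add: left_diff_distrib)
  qed
  ultimately show ?thesis using * r by (simp add: f_def)
qed

text \<open>Integrates the majorant of the characteristic integral over t. The term q / t is not
  integrable at 0, so a constant bound is used up to \<tau>; beyond \<tau> it yields the
  logarithm.\<close>

lemma has_integral_split_bound:
  fixes A C q \<tau> :: real
  assumes "0 < \<tau>" "\<tau> \<le> 2"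
  shows "((\<lambda>t. if t \<le> \<tau> then A else C + q / t) has_integral
    (A * \<tau> + (C * (2 - \<tau>) + q * (ln 2 - ln \<tau>)))) {0..2}"
proof (rule has_integral_combine[of 0 \<tau> 2])
  have "((\<lambda>t. A) has_integral (A * \<tau>)) {0..\<tau>}"
    using has_integral_const_real[of A 0 \<tau>] assms by (simp add: mult.commute)
  then show "((\<lambda>t. if t \<le> \<tau> then A else C + q / t) has_integral (A * \<tau>)) {0..\<tau>}"
    by (rule has_integral_eq[rotated]) simp
  have "((\<lambda>t. C + q / t) has_integral ((C * 2 + q * ln 2) - (C * \<tau> + q * ln \<tau>))) {\<tau>..2}"
    using assms
    by (intro fundamental_theorem_of_calculus)
       (auto intro!: derivative_eq_intros simp: has_real_derivative_iff_has_vector_derivative[symmetric])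
  then have "((\<lambda>t. C + q / t) has_integral (C * (2 - \<tau>) + q * (ln 2 - ln \<tau>))) {\<tau>..2}"
    by (simp add: algebra_simps)
  then show "((\<lambda>t. if t \<le> \<tau> then A else C + q / t) has_integral (C * (2 - \<tau>) + q * (ln 2 - ln \<tau>))) {\<tau>..2}"
    by (rule has_integral_spike_finite[of "{\<tau>}", rotated 2]) auto
qed (use assms in auto)

section \<open>Choice of parameters and combination of the estimates\<close>

theorem theorem3p6:
  fixes M :: "'a measure" and Xs :: "nat \<Rightarrow> 'x measure" and X :: "nat \<Rightarrow> 'a \<Rightarrow> 'x"
    and B :: "('a \<Rightarrow> real) set" and nrm :: "('a \<Rightarrow> real) \<Rightarrow> real" and \<delta> :: "nat \<Rightarrow> real"
    and r :: "'a \<Rightarrow> real" and g :: "nat \<Rightarrow> (nat \<Rightarrow> 'x) \<Rightarrow> real" and b :: "nat \<Rightarrow> real"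
    and n \<rho> :: nat and T :: real
    and N :: "'z measure" and Z :: "'z \<Rightarrow> real" and fZ :: "real \<Rightarrow> real"
  defines "c \<equiv> smoothing_const"
    and "S \<equiv> birkhoff_sum X g"
    and "\<nu> \<equiv> density M (\<lambda>x. ennreal (r x))"
  assumes "prob_space M"
    and "\<And>j. X j \<in> measurable M (Xs j)"
    and "decay_of_correlations M Xs X B nrm \<delta>"
    and "r \<in> B" and "\<And>x. x \<in> space M \<Longrightarrow> 0 \<le> r x" and "(\<integral>x. r x \<partial>M) = 1"
    and "\<And>j. g j \<in> borel_measurable (tail_space Xs j)"
    and "\<And>k. 0 < b k" and "filterlim b at_top sequentially"
    and "0 < \<rho>" and "\<rho> < n" and "1 \<le> T"
    and "prob_space N"
    and "distributed N lborel Z (\<lambda>t. ennreal (fZ t))"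
    and "\<And>t. 0 \<le> fZ t" and "bdd_above (range fZ)"
  shows "ereal (kolmogorov_dist \<nu> (\<lambda>x. S n x / b n) N Z)
    \<le> ereal ((4 * c + 1) * kolmogorov_dist M (\<lambda>x. S n x / b n) N Z)
      + 2 * ereal T * enn2ereal (\<integral>\<^sup>+x. ennreal (\<bar>S \<rho> x\<bar> * (1 + r x)) \<partial>M) / ereal (b n)
      + ereal (4 * \<delta> \<rho> * nrm r * ln T)
      + ereal (2 * (SUP t. fZ t) * c\<^sup>2 / T)
      + 2 * enn2ereal (\<integral>\<^sup>+x. ennreal ((r x + 1) * \<bar>S n x\<bar>) \<partial>M) / ereal (b n * T)"
proof -
  interpret prob_space M by fact
  note X = assms(5) and DC = assms(6) and rB = assms(7) and r_nonneg = assms(8) and r_one = assms(9)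
    and g = assms(10) and f_nonneg = assms(18)
  have c: "c = smoothing_const" and S: "S = birkhoff_sum X g"
    and \<nu>: "\<nu> = density M (\<lambda>x. ennreal (r x))"
    using assms(1-3) by simp_all
  have r_int: "integrable M r" using DC rB by (auto simp: decay_of_correlations_def)
  note [measurable] = borel_measurable_integrable[OF r_int]
  have S_meas [measurable]: "S m \<in> borel_measurable M" for m
    unfolding S by (rule measurable_birkhoff_sum[OF X g])
  have b: "0 < b n" and T: "1 \<le> T" "0 < T" using assms(11,15) by auto
  define I where "I m = (\<integral>\<^sup>+x. ennreal (\<bar>S m x\<bar> * (1 + r x)) \<partial>M)" for m
  have I_n: "(\<integral>\<^sup>+x. ennreal ((r x + 1) * \<bar>S n x\<bar>) \<partial>M) = I n"
    by (simp add: I_def mult.commute add.commute)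
  show ?thesis
  \<comment> \<open>If one of the two moments is infinite, so is the right-hand side. Otherwise all
    quantities are real and the integrability needed for Fourier inversion is available.\<close>
  proof (cases "I \<rho> = \<infinity> \<or> I n = \<infinity>")
    case True
    then have "2 * ereal T * enn2ereal (I \<rho>) / ereal (b n) = \<infinity> \<or> 2 * enn2ereal (I n) / ereal (b n * T) = \<infinity>"
      using b T by auto
    moreover have "2 * ereal T * enn2ereal (I \<rho>) / ereal (b n) \<ge> 0" "2 * enn2ereal (I n) / ereal (b n * T) \<ge> 0"
      using b T by auto
    ultimately show ?thesis
      unfolding I_n I_def[symmetric] by auto
  next
    case False
    define A where "A m = (\<integral>x. \<bar>S m x\<bar> * (1 + r x) \<partial>M)" for m
    have A_int: "integrable M (\<lambda>x. \<bar>S m x\<bar> * (1 + r x))" if "m = \<rho> \<or> m = n" for m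
      using False that r_nonneg
      by (intro integrableI_nonneg) (auto simp: I_def[symmetric] less_top)
    have A_eq: "enn2ereal (I m) = ereal (A m)" if "m = \<rho> \<or> m = n" for m
      using nn_integral_eq_integral[OF A_int[OF that]] r_nonneg
      by (simp add: I_def A_def integral_nonneg_AE enn2ereal_ennreal)
    have A_nonneg: "0 \<le> A m" for m
      using r_nonneg by (auto simp: A_def intro!: integral_nonneg_AE)
    have wS_int: "integrable M (\<lambda>x. (r x - 1) * S m x)"
      and wS_le: "(\<integral>x. \<bar>(r x - 1) * S m x\<bar> \<partial>M) \<le> A m" if m: "m = \<rho> \<or> m = n" for m
    proof -
      have *: "\<bar>(r x - 1) * S m x\<bar> \<le> \<bar>S m x\<bar> * (1 + r x)" if "x \<in> space M" for x
        using mult_right_mono[of "\<bar>r x - 1\<bar>" "1 + r x" "\<bar>S m x\<bar>"] r_nonneg[OF that]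
        by (simp add: abs_mult mult.commute)
      show int: "integrable M (\<lambda>x. (r x - 1) * S m x)"
        by (rule Bochner_Integration.integrable_bound[OF A_int[OF m]])
           (use * in \<open>auto intro!: AE_I2 order_trans[OF _ abs_ge_self]\<close>)
      show "(\<integral>x. \<bar>(r x - 1) * S m x\<bar> \<partial>M) \<le> A m"
        unfolding A_def using int A_int[OF m] * by (intro integral_mono) auto
    qed
    \<comment> \<open>With scale a = T/2, frequency t acts on a S_n / b_n as t \<theta> acts on S_n.
      The cutoff t \<le> 2 then means frequencies up to T for S_n / b_n.\<close>
    define \<theta> where "\<theta> = T / (2 * b n)"
    have \<theta>: "0 < \<theta>" using T b by (simp add: \<theta>_def)
    define q where "q = nrm r * \<delta> \<rho>"
    define \<phi> where "\<phi> t = cmod (\<integral>x. complex_of_real (r x - 1) * cis (t * \<theta> * S n x) \<partial>M)" for t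
    have perturb: "\<phi> t \<le> t * \<theta> * A m + cmod (\<integral>x. complex_of_real (r x - 1) * cis (t * \<theta> * R x) \<partial>M)"
      if "0 < t" "m = \<rho> \<or> m = n" "\<And>x. S n x = S m x + R x" and [measurable]: "R \<in> borel_measurable M" for t m R
    proof -
      have "\<phi> t = cmod (\<integral>x. complex_of_real (r x - 1) * cis (t * \<theta> * S m x + t * \<theta> * R x) \<partial>M)"
        by (simp add: \<phi>_def that(3) distrib_left)
      also have "\<dots> \<le> (\<integral>x. \<bar>(r x - 1) * (t * \<theta> * S m x)\<bar> \<partial>M)
          + cmod (\<integral>x. complex_of_real (r x - 1) * cis (t * \<theta> * R x) \<partial>M)"
      proof (rule char_perturbation)
        show "integrable M (\<lambda>x. (r x - 1) * (t * \<theta> * S m x))"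
          using integrable_mult_right[OF wS_int[OF that(2)], of "t * \<theta>"] by (simp only: mult_ac)
      qed (use r_int in auto)
      also have "(\<integral>x. \<bar>(r x - 1) * (t * \<theta> * S m x)\<bar> \<partial>M) = (\<integral>x. t * \<theta> * \<bar>(r x - 1) * S m x\<bar> \<partial>M)"
        using \<open>0 < t\<close> \<theta> by (intro Bochner_Integration.integral_cong) (auto simp: abs_mult)
      also have "\<dots> \<le> t * \<theta> * A m"
        using wS_le[OF that(2)] \<open>0 < t\<close> \<theta> by simp
      finally show ?thesis by simp
    qed
    \<comment> \<open>With R = 0 the remaining integral is that of r - 1, which is 0; so \<phi>(t) /
      t stays bounded near 0.\<close>
    have \<phi>_n: "\<phi> t \<le> t * \<theta> * A n" if "0 < t" for t
      using perturb[OF that, of n "\<lambda>_. 0"] r_int r_one by (simp add: prob_space)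
    have \<phi>_\<rho>: "\<phi> t \<le> t * \<theta> * A \<rho> + q" if t: "0 < t" for t
    proof -
      obtain h where h: "h \<in> borel_measurable (tail_space Xs \<rho>)"
        and split: "\<And>x. S n x = S \<rho> x + h (tail_map X \<rho> x)"
        using birkhoff_sum_split[OF g less_imp_le[OF \<open>\<rho> < n\<close>]] unfolding S by blast
      have "(\<lambda>x. h (tail_map X \<rho> x)) \<in> borel_measurable M"
        by (rule measurable_compose[OF measurable_tail_map[OF X] h])
      from perturb[OF t _ split this]
        decay_of_correlations_cis[OF \<open>prob_space M\<close> X DC rB r_one h, of "t * \<theta>"]
      show ?thesis by (simp add: q_def)
    qed
    \<comment> \<open>In the scale of S_n / b_n this is the frequency 1/T. It makes \<theta> \<tau>
      = 1 / (b_n T) and ln 2 - ln \<tau> = 2 ln T, whence the last term and the factor 4 ln T of the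
      claim.\<close>
    define \<tau> where "\<tau> = 2 / T\<^sup>2"
    have "1 \<le> T\<^sup>2" using T by (simp add: one_le_power)
    then have \<tau>: "0 < \<tau>" "\<tau> \<le> 2" by (auto simp: \<tau>_def divide_le_eq)
    define \<kappa> where "\<kappa> = \<theta> * A n * \<tau> + (\<theta> * A \<rho> * (2 - \<tau>) + q * (ln 2 - ln \<tau>))"
    define L where "L = (SUP t. fZ t)"
    have L: "fZ t \<le> L" for t
      unfolding L_def using assms(19) by (intro cSUP_upper) auto
    have "kolmogorov_dist \<nu> (\<lambda>x. S n x / b n) N Z
        \<le> (4 * c + 1) * kolmogorov_dist M (\<lambda>x. S n x / b n) N Z + 2 * \<kappa> + L * c\<^sup>2 / (T / 2)"
      unfolding \<nu> c
    proof (rule kolmogorov_dist_density_le[where f = fZ and \<beta> = "\<lambda>t. if t \<le> \<tau> then \<theta> * A n else \<theta> * A \<rho> + q / t"])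
      show "((\<lambda>t. if t \<le> \<tau> then \<theta> * A n else \<theta> * A \<rho> + q / t) has_integral \<kappa>) {0..2}"
        unfolding \<kappa>_def by (rule has_integral_split_bound[OF \<tau>])
      show "integrable M (\<lambda>x. (r x - 1) * (S n x / b n))"
        using integrable_divide[OF wS_int[of n], of "b n"] by simp
      show "(\<lambda>x. S n x / b n) \<in> borel_measurable M" by measurable
      show "0 \<le> L" using L[of 0] f_nonneg[of 0] by linarith
      fix t :: real assume t: "0 < t" "t \<le> 2"
      have "cmod (\<integral>x. complex_of_real (r x - 1) * cis (t * (T / 2 * (S n x / b n))) \<partial>M) = \<phi> t"
        by (simp add: \<phi>_def \<theta>_def mult.assoc)
      then show "cmod (\<integral>x. complex_of_real (r x - 1) * cis (t * (T / 2 * (S n x / b n))) \<partial>M) / t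
          \<le> (if t \<le> \<tau> then \<theta> * A n else \<theta> * A \<rho> + q / t)"
        using divide_right_mono[OF \<phi>_n[OF t(1)], of t] divide_right_mono[OF \<phi>_\<rho>[OF t(1)], of t] t
        by (simp only: add_divide_distrib) simp
    qed (use assms r_int L T in auto)
    moreover have "2 * \<kappa> + L * c\<^sup>2 / (T / 2) \<le> 2 * T * A \<rho> / b n + 4 * \<delta> \<rho> * nrm r * ln T
        + 2 * L * c\<^sup>2 / T + 2 * A n / (b n * T)"
    proof -
      have "2 * (q * (ln 2 - ln \<tau>)) = 4 * \<delta> \<rho> * nrm r * ln T"
        using T by (simp add: q_def \<tau>_def ln_div ln_realpow)
      moreover have "\<theta> * A n * \<tau> = A n / (b n * T)"
        using T b by (simp add: \<theta>_def \<tau>_def field_simps power2_eq_square)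
      moreover have "\<theta> * A \<rho> * (2 - \<tau>) \<le> \<theta> * A \<rho> * 2"
        using \<tau> \<theta> A_nonneg by (intro mult_left_mono) auto
      moreover have "\<theta> * A \<rho> * 2 = T * A \<rho> / b n"
        by (simp add: \<theta>_def)
      moreover have "2 * \<kappa> = 2 * (\<theta> * A n * \<tau>) + 2 * (\<theta> * A \<rho> * (2 - \<tau>)) + 2 * (q * (ln 2 - ln \<tau>))"
        by (simp add: \<kappa>_def)
      moreover have "L * c\<^sup>2 / (T / 2) = 2 * L * c\<^sup>2 / T" by simp
      ultimately show ?thesis by (simp only: times_divide_eq_right[symmetric] mult.assoc)
    qed
    ultimately have "kolmogorov_dist \<nu> (\<lambda>x. S n x / b n) N Z
        \<le> (4 * c + 1) * kolmogorov_dist M (\<lambda>x. S n x / b n) N Z + 2 * T * A \<rho> / b n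
          + 4 * \<delta> \<rho> * nrm r * ln T + 2 * L * c\<^sup>2 / T + 2 * A n / (b n * T)"
      by linarith
    then show ?thesis
      unfolding I_n I_def[symmetric] L_def[symmetric] using b T by (simp add: A_eq)
  qed
qed

end
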